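(* For every integer $n\ge 1$, the fugacity partition function at $q=y=1$ satisfies $$Z_n(1;\alpha,\beta,\gamma,\delta;1)=\prod_{j=0}^{n-1}\bigl(\alpha+\beta+\gamma+\delta+j(\alpha+\gamma)(\beta+\delta)\bigr).$$
   Context: A staircase tableau $\mathcal{T}$ of size $n$ is a Ferrers diagram of shape $(n,n-1,\dots,2,1)$ (English convention) whose boxes are either empty or labeled with one of $\alpha,\beta,\gamma,\delta$, such that: no box along the diagonal (the last box of each row) is empty; all boxes in the same row and to the left of a $\beta$ or a $\delta$ are empty; all boxes in the same column and above an $\alpha$ or a $\gamma$ are empty. The weight $\mathbf{w}(\mathcal{T})$ is a monomial in $\alpha,\beta,\gamma,\delta,q$. Every blank box is assigned $q$ or $1$ according to the closest labeled box to its right in its row and the closest labeled box below it in its column: if it sees a $\beta$ to its right it gets $1$; if it sees a $\delta$ to its right it gets $q$; if it sees an $\alpha$ or $\gamma$ to its right and an $\alpha$ or $\delta$ below it, it gets $1$; if it sees an $\alpha$ or $\gamma$ to its right and a $\beta$ or $\gamma$ below it, it gets $q$. Then $\mathbf{w}(\mathcal{T})$ is the product of all labels in all boxes. Let $t(\mathcal{T})$ be the number of labels $\alpha$ or $\delta$ along the diagonal of $\mathcal{T}$. The fugacity partition function is $$Z_n(y;\alpha,\beta,\gamma,\delta;q)=\sum_{\mathcal{T}\text{ of size }n}\mathbf{w}(\mathcal{T})\,y^{t(\mathcal{T})}.$$ *)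

theory Defs
  imports Main
begin

datatype label = Alpha | Beta | Gamma | Delta

text \<open>
  A box is a pair of a row and a column, both counted from 0, with rows numbered from top to
  bottom and columns from left to right. Row \<open>i\<close> of the staircase shape \<open>(n, n-1, ..., 1)\<close> has
  \<open>n - i\<close> boxes, so its last box, the diagonal box, is \<open>(i, n - 1 - i)\<close>.
\<close>

definition boxes :: "nat \<Rightarrow> (nat \<times> nat) set" where
  "boxes n = {(i, j). i < n \<and> j < n - i}"

text \<open>
  A filling is a partial map; \<open>None\<close> at a box of the shape means that the box is empty. Fillings
  have no labels outside the shape, so different maps in \<open>staircase_tableaux n\<close> are different
  tableaux.
\<close>

type_synonym filling = "nat \<times> nat \<Rightarrow> label option"

definition staircase_tableau :: "nat \<Rightarrow> filling \<Rightarrow> bool" where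
  "staircase_tableau n T \<longleftrightarrow>
     dom T \<subseteq> boxes n \<and>
     (\<forall>i<n. T (i, n - 1 - i) \<noteq> None) \<and>
     (\<forall>i j. T (i, j) \<in> {Some Beta, Some Delta} \<longrightarrow> (\<forall>k<j. T (i, k) = None)) \<and>
     (\<forall>i j. T (i, j) \<in> {Some Alpha, Some Gamma} \<longrightarrow> (\<forall>k<i. T (k, j) = None))"

definition staircase_tableaux :: "nat \<Rightarrow> filling set" where
  "staircase_tableaux n = {T. staircase_tableau n T}"

text \<open>
  The next two functions are meaningful only where a labeled box exists in the given direction;
  by \<open>sees_labels\<close> below this is so for every empty box of a staircase tableau.
\<close>

definition label_to_right :: "filling \<Rightarrow> nat \<Rightarrow> nat \<Rightarrow> label" where
  "label_to_right T i j = the (T (i, (LEAST k. j < k \<and> T (i, k) \<noteq> None)))"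

definition label_below :: "filling \<Rightarrow> nat \<Rightarrow> nat \<Rightarrow> label" where
  "label_below T i j = the (T ((LEAST k. i < k \<and> T (k, j) \<noteq> None), j))"

fun blank_weight :: "'a::comm_ring_1 \<Rightarrow> label \<Rightarrow> label \<Rightarrow> 'a" where
  "blank_weight q Beta _ = 1"
| "blank_weight q Delta _ = q"
| "blank_weight q _ Alpha = 1"
| "blank_weight q _ Delta = 1"
| "blank_weight q _ Beta = q"
| "blank_weight q _ Gamma = q"

fun label_weight :: "'a \<Rightarrow> 'a \<Rightarrow> 'a \<Rightarrow> 'a \<Rightarrow> label \<Rightarrow> 'a" where
  "label_weight \<alpha> \<beta> \<gamma> \<delta> Alpha = \<alpha>"
| "label_weight \<alpha> \<beta> \<gamma> \<delta> Beta = \<beta>"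
| "label_weight \<alpha> \<beta> \<gamma> \<delta> Gamma = \<gamma>"
| "label_weight \<alpha> \<beta> \<gamma> \<delta> Delta = \<delta>"

text \<open>
  Polynomials in \<open>\<alpha>, \<beta>, \<gamma>, \<delta>, q, y\<close> are represented by their values at arbitrary elements of an
  arbitrary commutative ring. An identity that holds for all such elements is the same as an
  identity of polynomials, since the ring may itself be a polynomial ring over the integers.
\<close>

definition tableau_weight ::
    "nat \<Rightarrow> 'a::comm_ring_1 \<Rightarrow> 'a \<Rightarrow> 'a \<Rightarrow> 'a \<Rightarrow> 'a \<Rightarrow> filling \<Rightarrow> 'a" where
  "tableau_weight n \<alpha> \<beta> \<gamma> \<delta> q T =
     (\<Prod>(i, j)\<in>boxes n.
        case T (i, j) of
          Some l \<Rightarrow> label_weight \<alpha> \<beta> \<gamma> \<delta> l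
        | None \<Rightarrow> blank_weight q (label_to_right T i j) (label_below T i j))"

definition diagonal_count :: "nat \<Rightarrow> filling \<Rightarrow> nat" where
  "diagonal_count n T = card {i. i < n \<and> T (i, n - 1 - i) \<in> {Some Alpha, Some Delta}}"

definition fugacity_partition_function ::
    "nat \<Rightarrow> 'a::comm_ring_1 \<Rightarrow> 'a \<Rightarrow> 'a \<Rightarrow> 'a \<Rightarrow> 'a \<Rightarrow> 'a \<Rightarrow> 'a" where
  "fugacity_partition_function n y \<alpha> \<beta> \<gamma> \<delta> q =
     (\<Sum>T\<in>staircase_tableaux n. tableau_weight n \<alpha> \<beta> \<gamma> \<delta> q T * y ^ diagonal_count n T)"

lemma finite_boxes: "finite (boxes n)"
  by (rule finite_subset[of _ "{..<n} \<times> {..<n}"]) (auto simp: boxes_def)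

lemma finite_staircase_tableaux: "finite (staircase_tableaux n)"
proof -
  have "(UNIV :: label set) \<subseteq> {Alpha, Beta, Gamma, Delta}"
    using label.exhaust by auto
  then have lab: "finite (UNIV :: label set)"
    by (rule finite_subset) simp
  have "finite {T :: filling. dom T = A \<and> ran T \<subseteq> UNIV}" if "A \<in> Pow (boxes n)" for A
    using that lab finite_boxes by (intro finite_set_of_finite_maps) (auto intro: finite_subset)
  then have "finite (\<Union>A\<in>Pow (boxes n). {T :: filling. dom T = A \<and> ran T \<subseteq> UNIV})"
    using finite_boxes by (intro finite_UN_I) simp_all
  moreover have "staircase_tableaux n \<subseteq>
      (\<Union>A\<in>Pow (boxes n). {T. dom T = A \<and> ran T \<subseteq> UNIV})"
    by (simp add: staircase_tableaux_def staircase_tableau_def subset_iff)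
  ultimately show ?thesis
    by (rule finite_subset[rotated])
qed

lemma sees_labels:
  assumes "staircase_tableau n T" "(i, j) \<in> boxes n" "T (i, j) = None"
  shows "\<exists>k>j. T (i, k) \<noteq> None" "\<exists>k>i. T (k, j) \<noteq> None"
proof -
  have diag: "T (k, n - 1 - k) \<noteq> None" if "k < n" for k
    using assms(1) that unfolding staircase_tableau_def by blast
  have ij: "i < n" "j < n - i"
    using assms(2) by (simp_all add: boxes_def)
  have "j \<noteq> n - 1 - i"
    using diag[OF ij(1)] assms(3) by metis
  with ij have right: "j < n - 1 - i" and below: "i < n - 1 - j" "n - 1 - j < n"
    and j: "n - 1 - (n - 1 - j) = j"
    by linarith+
  show "\<exists>k>j. T (i, k) \<noteq> None"
    using right diag[OF ij(1)] by blast
  show "\<exists>k>i. T (k, j) \<noteq> None"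
    using below(1) diag[OF below(2), unfolded j] by blast
qed

end

theory Submission
  imports Defs
begin

text \<open>
  At \<open>q = y = 1\<close> only the labels carry weight, so a tableau can be built one column at a time,
  from right to left. Write \<open>a = \<alpha> + \<gamma>\<close> and \<open>b = \<beta> + \<delta>\<close>. A tableau of size \<open>n + 1\<close> is a tableau
  of size \<open>n\<close>, shifted one step to the right, together with a new first column. A label of that
  column may only be put in an \<^emph>\<open>open\<close> row, one without \<open>\<beta>\<close> or \<open>\<delta>\<close> so far; the new bottom row
  is open and must receive a label. Hence the rest of the tableau matters only through the number
  of its open rows, and the sum is refined by a variable \<open>x\<close> that marks them:
  \<open>F n x = (\<Sum>T. weight T * x ^ (number of open rows of T))\<close>.

  The sum over all columns compatible with a tableau that has \<open>r\<close> open rows turns out to be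
  \<open>(a * x + b) * (x + b) ^ r\<close> (\<open>sum_nonempty_bottom_columns\<close>). It looks as if the bottom box
  chose freely between \<open>a * x\<close> and \<open>b\<close>, and every other open row freely between staying open and
  being closed by \<open>\<beta>\<close> or \<open>\<delta>\<close>: the constraint that a column ends above an \<open>\<alpha>\<close> or \<open>\<gamma>\<close> cancels
  exactly. Therefore \<open>F (n + 1) x = (a * x + b) * F n (x + b)\<close>, which iterates to
  \<open>F n x = (\<Prod>j<n. a * (x + j * b) + b)\<close>; the theorem is the case \<open>x = 1\<close>.
\<close>

section \<open>Sums over a single column\<close>

text \<open>
  The set \<open>R\<close> consists of the rows that are still open; only they may receive a label.
\<close>

definition columns :: "nat set \<Rightarrow> (nat \<Rightarrow> label option) set" where
  "columns R = {c. dom c \<subseteq> R \<and> (\<forall>i. c i \<in> {Some Alpha, Some Gamma} \<longrightarrow> (\<forall>k<i. c k = None))}"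

text \<open>
  The factor of an open row: besides the weight of its label, if any, a factor \<open>x\<close> records that
  the row stays open.
\<close>

fun open_row_weight :: "(label \<Rightarrow> 'a) \<Rightarrow> 'a \<Rightarrow> label option \<Rightarrow> 'a::comm_ring_1" where
  "open_row_weight w x None = x"
| "open_row_weight w x (Some Alpha) = w Alpha * x"
| "open_row_weight w x (Some Gamma) = w Gamma * x"
| "open_row_weight w x (Some Beta) = w Beta"
| "open_row_weight w x (Some Delta) = w Delta"

definition column_weight ::
    "(label \<Rightarrow> 'a) \<Rightarrow> 'a \<Rightarrow> nat set \<Rightarrow> (nat \<Rightarrow> label option) \<Rightarrow> 'a::comm_ring_1" where
  "column_weight w x R c = (\<Prod>i\<in>R. open_row_weight w x (c i))"

lemma not_None_label_cases:
  "v \<noteq> None \<longleftrightarrow> v = Some Alpha \<or> v = Some Beta \<or> v = Some Gamma \<or> v = Some Delta"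
  by (metis label.exhaust not_Some_eq option.distinct(1))

lemma column_outside: "c \<in> columns R \<Longrightarrow> i \<notin> R \<Longrightarrow> c i = None"
  unfolding columns_def by blast

lemma column_above_empty:
  assumes "c \<in> columns R" "c i \<in> {Some Alpha, Some Gamma}" "k < i"
  shows "c k = None"
proof -
  have "\<forall>i. c i \<in> {Some Alpha, Some Gamma} \<longrightarrow> (\<forall>k<i. c k = None)"
    using assms(1) unfolding columns_def mem_Collect_eq by (rule conjunct2)
  then show ?thesis using assms(2,3) by (elim allE impE)
qed

lemma columnsI:
  assumes "\<And>i. c i \<noteq> None \<Longrightarrow> i \<in> R"
    and "\<And>i k. c i \<in> {Some Alpha, Some Gamma} \<Longrightarrow> k < i \<Longrightarrow> c k = None"
  shows "c \<in> columns R"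
proof -
  have "dom c \<subseteq> R" using assms(1) by (auto simp: domIff)
  moreover have "\<forall>i. c i \<in> {Some Alpha, Some Gamma} \<longrightarrow> (\<forall>k<i. c k = None)"
    using assms(2) by meson
  ultimately show ?thesis unfolding columns_def mem_Collect_eq by (rule conjI)
qed

lemma columns_empty: "columns {} = {\<lambda>i. None}"
  by (auto simp: columns_def)

lemma columns_insert_bottom_empty:
  assumes "\<forall>i\<in>R. i < m"
  shows "{c \<in> columns (insert m R). c m = None} = columns R"
proof -
  have "m \<notin> R" using assms by blast
  then have "dom c \<subseteq> insert m R \<and> c m = None \<longleftrightarrow> dom c \<subseteq> R" for c :: "nat \<Rightarrow> label option"
    by (auto simp: subset_iff domIff)
  then have "c \<in> columns (insert m R) \<and> c m = None \<longleftrightarrow> c \<in> columns R" for c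
    unfolding columns_def mem_Collect_eq by meson
  then show ?thesis by blast
qed

lemma columns_insert_bottom_closing:
  assumes "\<forall>i\<in>R. i < m" and "l \<in> {Beta, Delta}"
  shows "{c \<in> columns (insert m R). c m = Some l} = (\<lambda>c. c(m \<mapsto> l)) ` columns R"
proof (intro equalityI subsetI)
  fix c assume "c \<in> {c \<in> columns (insert m R). c m = Some l}"
  then have c: "c \<in> columns (insert m R)" "c m = Some l"
    by simp_all
  have "c(m := None) \<in> columns R"
  proof (rule columnsI)
    fix i assume "(c(m := None)) i \<noteq> None"
    then show "i \<in> R"
      using column_outside[OF c(1), of i] by (cases "i \<in> R") (auto split: if_splits)
  next
    fix i k assume "(c(m := None)) i \<in> {Some Alpha, Some Gamma}" "k < i"
    then show "(c(m := None)) k = None"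
      using column_above_empty[OF c(1), of i k] by (auto split: if_splits)
  qed
  moreover have "c = (c(m := None))(m \<mapsto> l)"
    using c(2) by auto
  ultimately show "c \<in> (\<lambda>c. c(m \<mapsto> l)) ` columns R"
    by blast
next
  fix c assume "c \<in> (\<lambda>c. c(m \<mapsto> l)) ` columns R"
  then obtain d where d: "d \<in> columns R" "c = d(m \<mapsto> l)"
    by blast
  have "c \<in> columns (insert m R)"
  proof (rule columnsI)
    fix i assume "c i \<noteq> None"
    then show "i \<in> insert m R"
      using column_outside[OF d(1), of i] d(2) by (cases "i \<in> R") (auto split: if_splits)
  next
    fix i k assume i: "c i \<in> {Some Alpha, Some Gamma}" and "k < i"
    have "i \<noteq> m"
      using i d(2) assms(2) by auto
    then have di: "d i \<in> {Some Alpha, Some Gamma}"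
      using i d(2) by simp
    then have "i \<in> R"
      using column_outside[OF d(1), of i] by (cases "i \<in> R") auto
    then have "k \<noteq> m"
      using assms(1) \<open>k < i\<close> by auto
    then show "c k = None"
      using column_above_empty[OF d(1) di \<open>k < i\<close>] d(2) by simp
  qed
  then show "c \<in> {c \<in> columns (insert m R). c m = Some l}"
    using d(2) by simp
qed

lemma columns_insert_bottom_ending:
  assumes "\<forall>i\<in>R. i < m" and "l \<in> {Alpha, Gamma}"
  shows "{c \<in> columns (insert m R). c m = Some l} = {[m \<mapsto> l]}"
proof -
  have "c = [m \<mapsto> l]" if c: "c \<in> columns (insert m R)" "c m = Some l" for c
  proof
    fix i
    have "c i = None" if "i \<noteq> m"
    proof (cases "i < m")
      case True
      then show ?thesis using column_above_empty[OF c(1), of m i] c(2) assms(2) by auto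
    next
      case False
      then have "i \<notin> insert m R" using that assms(1) by auto
      then show ?thesis by (rule column_outside[OF c(1)])
    qed
    then show "c i = [m \<mapsto> l] i" using c(2) by simp
  qed
  moreover have "[m \<mapsto> l] \<in> columns (insert m R)"
    by (rule columnsI) (auto split: if_splits)
  moreover have "[m \<mapsto> l] m = Some l"
    by simp
  ultimately show ?thesis by blast
qed

lemma finite_columns:
  assumes "finite R"
  shows "finite (columns R)"
  using assms
proof (induction R rule: finite_linorder_max_induct)
  case empty
  then show ?case by (simp add: columns_empty)
next
  case (insert m R)
  note below = insert.hyps(2)
  let ?C = "columns (insert m R)"
  have "?C \<subseteq> {c \<in> ?C. c m = None} \<union> {c \<in> ?C. c m = Some Alpha} \<union> {c \<in> ?C. c m = Some Beta}
      \<union> {c \<in> ?C. c m = Some Gamma} \<union> {c \<in> ?C. c m = Some Delta}"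
    using not_None_label_cases by blast
  moreover have "finite \<dots>"
    using insert.IH
    by (simp add: columns_insert_bottom_empty[OF below] columns_insert_bottom_closing[OF below]
        columns_insert_bottom_ending[OF below])
  ultimately show ?case by (rule finite_subset)
qed

lemma column_weight_update_bottom:
  assumes "finite R" and "\<forall>i\<in>R. i < m"
  shows "column_weight w x (insert m R) (c(m := v)) = open_row_weight w x v * column_weight w x R c"
proof -
  have "m \<notin> R" using assms(2) by blast
  then show ?thesis
    unfolding column_weight_def using assms(1) by (auto intro!: arg_cong2[of _ _ _ _ "(*)"] prod.cong)
qed

lemma column_weight_blank: "column_weight w x R (\<lambda>i. None) = x ^ card R"
  by (simp add: column_weight_def)

text \<open>
  The bottom label decides what can lie above it: \<open>\<alpha>\<close> or \<open>\<gamma>\<close> forces the rest of the column to be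
  empty and keeps all rows open, \<open>\<beta>\<close> or \<open>\<delta>\<close> closes the bottom row and leaves the rest free.
\<close>

lemma sum_columns_nonempty_bottom_step:
  fixes w :: "label \<Rightarrow> 'a::comm_ring_1"
  assumes "finite R" and below: "\<forall>i\<in>R. i < m"
  shows "(\<Sum>c | c \<in> columns (insert m R) \<and> c m \<noteq> None. column_weight w x (insert m R) c) =
    (w Alpha + w Gamma) * x * x ^ card R
      + (w Beta + w Delta) * (\<Sum>c\<in>columns R. column_weight w x R c)"
proof -
  let ?C = "columns (insert m R)" and ?W = "column_weight w x (insert m R)"
  let ?S = "\<lambda>l. {c \<in> ?C. c m = Some l}"
  have fin: "finite (?S l)" for l
    using finite_columns assms(1) by simp
  have split: "{c. c \<in> ?C \<and> c m \<noteq> None} = ?S Alpha \<union> (?S Beta \<union> (?S Gamma \<union> ?S Delta))"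
    using not_None_label_cases by blast
  have parts: "sum ?W (?S Alpha \<union> (?S Beta \<union> (?S Gamma \<union> ?S Delta))) =
      sum ?W (?S Alpha) + (sum ?W (?S Beta) + (sum ?W (?S Gamma) + sum ?W (?S Delta)))"
  proof -
    have "sum ?W (?S Gamma \<union> ?S Delta) = sum ?W (?S Gamma) + sum ?W (?S Delta)"
      by (rule sum.union_disjoint) (use fin in auto)
    moreover have "sum ?W (?S Beta \<union> (?S Gamma \<union> ?S Delta)) =
        sum ?W (?S Beta) + sum ?W (?S Gamma \<union> ?S Delta)"
      by (rule sum.union_disjoint) (use fin in auto)
    moreover have "sum ?W (?S Alpha \<union> (?S Beta \<union> (?S Gamma \<union> ?S Delta))) =
        sum ?W (?S Alpha) + sum ?W (?S Beta \<union> (?S Gamma \<union> ?S Delta))"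
      by (rule sum.union_disjoint) (use fin in auto)
    ultimately show ?thesis by (simp only:)
  qed
  have ending: "sum ?W (?S l) = w l * x * x ^ card R" if "l \<in> {Alpha, Gamma}" for l
    using that columns_insert_bottom_ending[OF below that]
      column_weight_update_bottom[OF assms, of w x "\<lambda>i. None"] column_weight_blank[of w x R]
    by auto
  have closing: "sum ?W (?S l) = w l * (\<Sum>c\<in>columns R. column_weight w x R c)"
    if "l \<in> {Beta, Delta}" for l
  proof -
    have "m \<notin> R" using below by blast
    then have "c m = None" if "c \<in> columns R" for c
      using that by (rule column_outside[rotated])
    then have "inj_on (\<lambda>c. c(m \<mapsto> l)) (columns R)"
      by (intro inj_onI) (metis fun_upd_triv fun_upd_upd)
    then have "sum ?W (?S l) = (\<Sum>c\<in>columns R. ?W (c(m \<mapsto> l)))"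
      by (simp add: columns_insert_bottom_closing[OF below that] sum.reindex)
    also have "\<dots> = (\<Sum>c\<in>columns R. w l * column_weight w x R c)"
      using that by (intro sum.cong refl) (auto simp: column_weight_update_bottom[OF assms])
    finally show ?thesis
      by (simp add: sum_distrib_left)
  qed
  have "sum ?W (?S Alpha) = w Alpha * x * x ^ card R"
    and "sum ?W (?S Gamma) = w Gamma * x * x ^ card R"
    using ending by blast+
  moreover have "sum ?W (?S Beta) = w Beta * (\<Sum>c\<in>columns R. column_weight w x R c)"
    and "sum ?W (?S Delta) = w Delta * (\<Sum>c\<in>columns R. column_weight w x R c)"
    using closing by blast+
  ultimately show ?thesis
    unfolding split parts by (simp only: algebra_simps)
qed

text \<open>
  Let \<open>r = card R\<close>. Columns without \<open>\<alpha>\<close> and \<open>\<gamma>\<close> contribute \<open>(x + b) ^ r\<close>. If the \<open>\<alpha>\<close> or \<open>\<gamma>\<close> has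
  \<open>k\<close> open rows below it, these contribute \<open>(x + b) ^ k\<close> and the \<open>r - 1 - k\<close> rows above, being
  empty, contribute \<open>x\<close> each; so these columns sum to
  \<open>a * x * (\<Sum>k<r. (x + b) ^ k * x ^ (r - 1 - k))\<close>. Multiplied by \<open>b = (x + b) - x\<close> this geometric sum
  telescopes. The factor \<open>b\<close> remains in the statement because a commutative ring allows no
  division by it.
\<close>

lemma sum_columns_times:
  fixes w :: "label \<Rightarrow> 'a::comm_ring_1"
  assumes "finite R"
  defines "a \<equiv> w Alpha + w Gamma" and "b \<equiv> w Beta + w Delta"
  shows "b * (\<Sum>c\<in>columns R. column_weight w x R c) =
    (a * x + b) * (x + b) ^ card R - a * x * x ^ card R"
  using assms(1)
proof (induction R rule: finite_linorder_max_induct)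
  case empty
  then show ?case by (simp add: columns_empty column_weight_def)
next
  case (insert m R)
  note below = insert.hyps(2)
  let ?C = "columns (insert m R)" and ?W = "column_weight w x (insert m R)"
  let ?H = "\<Sum>c\<in>columns R. column_weight w x R c"
  have card: "card (insert m R) = Suc (card R)"
    using insert.hyps by auto
  have "sum ?W ?C = sum ?W ({c \<in> ?C. c m = None} \<union> {c. c \<in> ?C \<and> c m \<noteq> None})"
    by (rule arg_cong[of _ _ "sum ?W"]) blast
  also have "\<dots> = sum ?W {c \<in> ?C. c m = None} + sum ?W {c. c \<in> ?C \<and> c m \<noteq> None}"
    by (rule sum.union_disjoint) (use finite_columns[of "insert m R"] insert.hyps(1) in auto)
  also have "sum ?W {c \<in> ?C. c m = None} = (\<Sum>c\<in>columns R. x * column_weight w x R c)"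
  proof -
    have "?W c = x * column_weight w x R c" if "c \<in> columns R" for c
    proof -
      have "m \<notin> R" using below by blast
      then have "c m = None" by (rule column_outside[OF that])
      then have "c(m := None) = c" by (metis fun_upd_triv)
      then show ?thesis
        using column_weight_update_bottom[OF insert.hyps(1) below, of w x c None] by simp
    qed
    then show ?thesis
      unfolding columns_insert_bottom_empty[OF below] by (intro sum.cong) auto
  qed
  also have "\<dots> = x * ?H"
    by (simp add: sum_distrib_left)
  also have "sum ?W {c. c \<in> ?C \<and> c m \<noteq> None} = a * x * x ^ card R + b * ?H"
    unfolding a_def b_def by (rule sum_columns_nonempty_bottom_step[OF insert.hyps(1) below])
  finally have "b * sum ?W ?C = (x + b) * (b * ?H) + b * (a * x * x ^ card R)"
    by (simp add: algebra_simps)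
  then show ?case
    unfolding insert.IH card by (simp add: algebra_simps)
qed

text \<open>
  A bottom label \<open>\<beta>\<close> or \<open>\<delta>\<close> supplies the factor \<open>b\<close> of \<open>sum_columns_times\<close>, and the term
  subtracted there is exactly what the columns with bottom label \<open>\<alpha>\<close> or \<open>\<gamma>\<close> add.
\<close>

lemma sum_nonempty_bottom_columns:
  fixes w :: "label \<Rightarrow> 'a::comm_ring_1"
  assumes "finite R" and "\<forall>i\<in>R. i < m"
  shows "(\<Sum>c | c \<in> columns (insert m R) \<and> c m \<noteq> None. column_weight w x (insert m R) c) =
    ((w Alpha + w Gamma) * x + (w Beta + w Delta)) * (x + (w Beta + w Delta)) ^ card R"
  unfolding sum_columns_nonempty_bottom_step[OF assms] sum_columns_times[OF assms(1)]
  by simp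

section \<open>Splitting off the first column of a tableau\<close>

definition open_rows :: "nat \<Rightarrow> filling \<Rightarrow> nat set" where
  "open_rows n T = {i. i < n \<and> (\<forall>j. T (i, j) \<notin> {Some Beta, Some Delta})}"

definition prepend_column :: "(nat \<Rightarrow> label option) \<Rightarrow> filling \<Rightarrow> filling" where
  "prepend_column c T = (\<lambda>(i, j). case j of 0 \<Rightarrow> c i | Suc k \<Rightarrow> T (i, k))"

definition remove_column :: "filling \<Rightarrow> filling" where
  "remove_column T = (\<lambda>(i, j). T (i, Suc j))"

definition labels_weight :: "nat \<Rightarrow> (label \<Rightarrow> 'a) \<Rightarrow> filling \<Rightarrow> 'a::comm_ring_1" where
  "labels_weight n w T = (\<Prod>p\<in>boxes n. case T p of None \<Rightarrow> 1 | Some l \<Rightarrow> w l)"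

text \<open>
  The columns that may precede \<open>T\<close>: row \<open>n\<close> is the bottom row that \<open>T\<close> does not have yet, and its
  box in the new column lies on the diagonal.
\<close>

definition first_columns :: "nat \<Rightarrow> filling \<Rightarrow> (nat \<Rightarrow> label option) set" where
  "first_columns n T = {c. c \<in> columns (insert n (open_rows n T)) \<and> c n \<noteq> None}"

lemma prepend_column_simps [simp]:
  "prepend_column c T (i, 0) = c i"
  "prepend_column c T (i, Suc j) = T (i, j)"
  by (simp_all add: prepend_column_def)

lemma remove_column_simps [simp]: "remove_column T (i, j) = T (i, Suc j)"
  by (simp add: remove_column_def)

lemma remove_prepend_column: "remove_column (prepend_column c T) = T"
  by (auto simp: remove_column_def)

lemma prepend_remove_column: "prepend_column (\<lambda>i. T (i, 0)) (remove_column T) = T"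
  by (auto simp: prepend_column_def fun_eq_iff split: nat.split)

lemma finite_open_rows: "finite (open_rows n T)"
  by (simp add: open_rows_def)

lemma open_rows_less: "\<forall>i\<in>open_rows n T. i < n"
  by (simp add: open_rows_def)

lemma tableau_outside:
  assumes "staircase_tableau n T" "(i, j) \<notin> boxes n"
  shows "T (i, j) = None"
  using assms unfolding staircase_tableau_def by blast

lemma tableau_diagonal:
  assumes "staircase_tableau n T" "i < n"
  shows "T (i, n - 1 - i) \<noteq> None"
  using assms unfolding staircase_tableau_def by meson

lemma tableau_left_empty:
  assumes "staircase_tableau n T" "T (i, j) \<in> {Some Beta, Some Delta}" "k < j"
  shows "T (i, k) = None"
  using assms unfolding staircase_tableau_def by meson

lemma tableau_above_empty:
  assumes "staircase_tableau n T" "T (i, j) \<in> {Some Alpha, Some Gamma}" "k < i"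
  shows "T (k, j) = None"
  using assms unfolding staircase_tableau_def by meson

lemma first_columns_columns: "c \<in> first_columns n T \<Longrightarrow> c \<in> columns (insert n (open_rows n T))"
  by (simp add: first_columns_def)

lemma first_columns_bottom: "c \<in> first_columns n T \<Longrightarrow> c n \<noteq> None"
  by (simp add: first_columns_def)

lemma first_columns_outside:
  "c \<in> first_columns n T \<Longrightarrow> i \<noteq> n \<Longrightarrow> i \<notin> open_rows n T \<Longrightarrow> c i = None"
  by (rule column_outside[OF first_columns_columns]) simp_all

text \<open>
  Only the row condition links the first column to the others: a \<open>\<beta>\<close> or \<open>\<delta>\<close> further right
  forbids a label in the first column, which is what \<open>open_rows\<close> expresses. The column condition
  concerns each column by itself. The same remark proves the converse, \<open>first_column_of_tableau\<close>.
\<close>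

lemma staircase_tableau_prepend_column:
  assumes T: "staircase_tableau n T" and c: "c \<in> first_columns n T"
  shows "staircase_tableau (Suc n) (prepend_column c T)"
  unfolding staircase_tableau_def
proof (intro conjI allI impI)
  let ?P = "prepend_column c T"
  show "dom ?P \<subseteq> boxes (Suc n)"
  proof
    fix p assume "p \<in> dom ?P"
    obtain i j where p: "p = (i, j)" by force
    show "p \<in> boxes (Suc n)"
    proof (cases j)
      case 0
      then have "c i \<noteq> None" using \<open>p \<in> dom ?P\<close> p by auto
      then show ?thesis
        using first_columns_outside[OF c, of i] p 0
        by (cases "i = n"; cases "i \<in> open_rows n T") (auto simp: boxes_def open_rows_def)
    next
      case (Suc k)
      then have "(i, k) \<in> boxes n"
        using \<open>p \<in> dom ?P\<close> p tableau_outside[OF T, of i k] by (cases "(i, k) \<in> boxes n") auto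
      then show ?thesis using p Suc by (auto simp: boxes_def)
    qed
  qed
next
  fix i assume "i < Suc n"
  show "prepend_column c T (i, Suc n - 1 - i) \<noteq> None"
  proof (cases "i = n")
    case True
    then show ?thesis using first_columns_bottom[OF c] by simp
  next
    case False
    then have "i < n" "Suc n - 1 - i = Suc (n - 1 - i)" using \<open>i < Suc n\<close> by auto
    then show ?thesis
      using tableau_diagonal[OF T, of i] by simp
  qed
next
  fix i j k
  assume l: "prepend_column c T (i, j) \<in> {Some Beta, Some Delta}" and "k < j"
  then obtain j' where j: "j = Suc j'" by (cases j) auto
  show "prepend_column c T (i, k) = None"
  proof (cases k)
    case 0
    have "T (i, j') \<noteq> None" using l j by auto
    then have "i < n"
      using tableau_outside[OF T, of i j'] by (cases "i < n") (simp_all add: boxes_def)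
    moreover have "i \<notin> open_rows n T" using l j by (auto simp: open_rows_def)
    ultimately have "c i = None"
      using first_columns_outside[OF c, of i] by simp
    then show ?thesis using 0 by simp
  next
    case (Suc k')
    then show ?thesis
      using tableau_left_empty[OF T, of i j' k'] l \<open>k < j\<close> j by simp
  qed
next
  fix i j k
  assume l: "prepend_column c T (i, j) \<in> {Some Alpha, Some Gamma}" and "k < i"
  show "prepend_column c T (k, j) = None"
  proof (cases j)
    case 0
    then show ?thesis
      using l \<open>k < i\<close> column_above_empty[OF first_columns_columns[OF c], of i k] by simp
  next
    case (Suc j')
    then show ?thesis
      using tableau_above_empty[OF T, of i j' k] l \<open>k < i\<close> by simp
  qed
qed

lemma staircase_tableau_remove_column:
  assumes T: "staircase_tableau (Suc n) T"
  shows "staircase_tableau n (remove_column T)"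
  unfolding staircase_tableau_def
proof (intro conjI allI impI)
  show "dom (remove_column T) \<subseteq> boxes n"
  proof
    fix p assume "p \<in> dom (remove_column T)"
    moreover obtain i j where p: "p = (i, j)" by force
    ultimately have "(i, Suc j) \<in> boxes (Suc n)"
      using tableau_outside[OF T, of i "Suc j"]
      by (cases "(i, Suc j) \<in> boxes (Suc n)") auto
    then show "p \<in> boxes n" using p by (auto simp: boxes_def)
  qed
next
  fix i assume "i < n"
  then have "Suc (n - 1 - i) = Suc n - 1 - i" by auto
  then show "remove_column T (i, n - 1 - i) \<noteq> None"
    using tableau_diagonal[OF T, of i] \<open>i < n\<close> by simp
next
  fix i j k
  assume "remove_column T (i, j) \<in> {Some Beta, Some Delta}" "k < j"
  then show "remove_column T (i, k) = None"
    using tableau_left_empty[OF T, of i "Suc j" "Suc k"] by simp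
next
  fix i j k
  assume "remove_column T (i, j) \<in> {Some Alpha, Some Gamma}" "k < i"
  then show "remove_column T (k, j) = None"
    using tableau_above_empty[OF T, of i "Suc j" k] by simp
qed

lemma first_column_of_tableau:
  assumes T: "staircase_tableau (Suc n) T"
  shows "(\<lambda>i. T (i, 0)) \<in> first_columns n (remove_column T)"
proof -
  have "i \<in> insert n (open_rows n (remove_column T))" if l: "T (i, 0) \<noteq> None" for i
  proof -
    have "i < Suc n"
      using tableau_outside[OF T, of i 0] l by (auto simp: boxes_def)
    moreover have "T (i, Suc j) \<notin> {Some Beta, Some Delta}" for j
      using tableau_left_empty[OF T, of i "Suc j" 0] l by auto
    ultimately show ?thesis
      by (auto simp: open_rows_def)
  qed
  moreover have "T (n, 0) \<noteq> None"
    using tableau_diagonal[OF T, of n] by simp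
  moreover have "T (k, 0) = None" if "T (i, 0) \<in> {Some Alpha, Some Gamma}" "k < i" for i k
    using tableau_above_empty[OF T that] .
  ultimately show ?thesis
    unfolding first_columns_def by (intro CollectI conjI columnsI)
qed

lemma labels_weight_prepend_column:
  "labels_weight (Suc n) w (prepend_column c T) =
    (\<Prod>i<Suc n. case c i of None \<Rightarrow> 1 | Some l \<Rightarrow> w l) * labels_weight n w T"
proof -
  let ?f = "\<lambda>p. case prepend_column c T p of None \<Rightarrow> 1 | Some l \<Rightarrow> w l"
  let ?A = "(\<lambda>i. (i, 0)) ` {..<Suc n}" and ?B = "(\<lambda>(i, j). (i, Suc j)) ` boxes n"
  have "boxes (Suc n) = ?A \<union> ?B"
  proof (intro equalityI subsetI)
    fix p assume p: "p \<in> boxes (Suc n)"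
    obtain i j where ij: "p = (i, j)" by force
    show "p \<in> ?A \<union> ?B"
    proof (cases j)
      case 0
      then show ?thesis using p ij by (auto simp: boxes_def)
    next
      case (Suc k)
      then have "(i, k) \<in> boxes n" using p ij by (auto simp: boxes_def)
      then show ?thesis using ij Suc by force
    qed
  qed (auto simp: boxes_def)
  then have "labels_weight (Suc n) w (prepend_column c T) = prod ?f (?A \<union> ?B)"
    by (simp add: labels_weight_def)
  also have "\<dots> = prod ?f ?A * prod ?f ?B"
    by (rule prod.union_disjoint) (auto simp: finite_boxes)
  also have "prod ?f ?A = (\<Prod>i<Suc n. case c i of None \<Rightarrow> 1 | Some l \<Rightarrow> w l)"
    by (subst prod.reindex) (auto simp: inj_on_def)
  also have "prod ?f ?B = labels_weight n w T"
    unfolding labels_weight_def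
    by (subst prod.reindex) (auto simp: inj_on_def intro!: prod.cong)
  finally show ?thesis .
qed

lemma open_rows_prepend_column:
  assumes T: "staircase_tableau n T"
  shows "open_rows (Suc n) (prepend_column c T) =
    {i \<in> insert n (open_rows n T). c i \<notin> {Some Beta, Some Delta}}"
proof -
  have row: "(\<forall>j. prepend_column c T (i, j) \<notin> {Some Beta, Some Delta}) \<longleftrightarrow>
      c i \<notin> {Some Beta, Some Delta} \<and> (\<forall>j. T (i, j) \<notin> {Some Beta, Some Delta})" for i
    by (metis not0_implies_Suc prepend_column_simps)
  \<comment> \<open>the new bottom row is empty in \<open>T\<close>, hence open before the column is added\<close>
  have "T (n, j) = None" for j
    using tableau_outside[OF T, of n j] by (simp add: boxes_def)
  then show ?thesis
    unfolding open_rows_def row by (auto simp: less_Suc_eq)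
qed

text \<open>
  Rows that were already closed are blank in the new column and stay closed, so that the product
  over all rows may be restricted to those that \<open>column_weight\<close> counts.
\<close>

lemma weight_prepend_column:
  assumes T: "staircase_tableau n T" and c: "c \<in> first_columns n T"
  shows "labels_weight (Suc n) w (prepend_column c T)
      * x ^ card (open_rows (Suc n) (prepend_column c T)) =
    labels_weight n w T * column_weight w x (insert n (open_rows n T)) c"
proof -
  let ?R = "insert n (open_rows n T)"
  let ?w = "\<lambda>i. case c i of None \<Rightarrow> 1 | Some l \<Rightarrow> w l"
  have fin: "finite ?R" by (simp add: finite_open_rows)
  have "c i = None" if "i \<notin> ?R" for i
    using that by (rule column_outside[OF first_columns_columns[OF c]])
  then have "prod ?w {..<Suc n} = prod ?w ?R"
    by (intro prod.mono_neutral_right) (auto simp: open_rows_def)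
  moreover have "x ^ card (open_rows (Suc n) (prepend_column c T)) =
      (\<Prod>i\<in>?R. if c i \<notin> {Some Beta, Some Delta} then x else 1)"
    unfolding open_rows_prepend_column[OF T] prod.inter_filter[OF fin, symmetric] by simp
  moreover have "open_row_weight w x (c i) =
      ?w i * (if c i \<notin> {Some Beta, Some Delta} then x else 1)" for i
    by (cases "(w, x, c i)" rule: open_row_weight.cases) auto
  ultimately show ?thesis
    unfolding labels_weight_prepend_column column_weight_def
    by (simp add: prod.distrib mult_ac)
qed

section \<open>The refined partition function\<close>

lemma sum_tableaux_Suc:
  fixes w :: "label \<Rightarrow> 'a::comm_ring_1"
  defines "a \<equiv> w Alpha + w Gamma" and "b \<equiv> w Beta + w Delta"
  shows "(\<Sum>T\<in>staircase_tableaux (Suc n). labels_weight (Suc n) w T * x ^ card (open_rows (Suc n) T)) =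
    (a * x + b) * (\<Sum>T\<in>staircase_tableaux n. labels_weight n w T * (x + b) ^ card (open_rows n T))"
proof -
  let ?W = "\<lambda>T c. labels_weight n w T * column_weight w x (insert n (open_rows n T)) c"
  have fin: "finite (first_columns n T)" for T
    unfolding first_columns_def using finite_columns[of "insert n (open_rows n T)"]
    by (simp add: finite_open_rows)
  have "(\<Sum>T\<in>staircase_tableaux (Suc n). labels_weight (Suc n) w T * x ^ card (open_rows (Suc n) T)) =
      (\<Sum>(T, c)\<in>(SIGMA T:staircase_tableaux n. first_columns n T). ?W T c)"
  proof (rule sum.reindex_bij_witness[where
        j = "\<lambda>T. (remove_column T, \<lambda>i. T (i, 0))" and i = "\<lambda>(T, c). prepend_column c T"])
    fix T assume "T \<in> staircase_tableaux (Suc n)"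
    then have T: "staircase_tableau (Suc n) T" by (simp add: staircase_tableaux_def)
    show "(case (remove_column T, \<lambda>i. T (i, 0)) of (T, c) \<Rightarrow> prepend_column c T) = T"
      by (simp add: prepend_remove_column)
    show "(remove_column T, \<lambda>i. T (i, 0)) \<in> (SIGMA T:staircase_tableaux n. first_columns n T)"
      using staircase_tableau_remove_column[OF T] first_column_of_tableau[OF T]
      by (simp add: staircase_tableaux_def)
    show "(case (remove_column T, \<lambda>i. T (i, 0)) of (T, c) \<Rightarrow> ?W T c) =
        labels_weight (Suc n) w T * x ^ card (open_rows (Suc n) T)"
      using weight_prepend_column[OF staircase_tableau_remove_column[OF T]
          first_column_of_tableau[OF T], of w x]
      by (simp add: prepend_remove_column)
  next
    fix p assume "p \<in> (SIGMA T:staircase_tableaux n. first_columns n T)"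
    then obtain T c where p: "p = (T, c)" "staircase_tableau n T" "c \<in> first_columns n T"
      by (auto simp: staircase_tableaux_def)
    show "(remove_column (case p of (T, c) \<Rightarrow> prepend_column c T),
        \<lambda>i. (case p of (T, c) \<Rightarrow> prepend_column c T) (i, 0)) = p"
      using p(1) by (simp add: remove_prepend_column)
    show "(case p of (T, c) \<Rightarrow> prepend_column c T) \<in> staircase_tableaux (Suc n)"
      using staircase_tableau_prepend_column[OF p(2,3)] p(1) by (simp add: staircase_tableaux_def)
  qed
  also have "\<dots> = (\<Sum>T\<in>staircase_tableaux n. \<Sum>c\<in>first_columns n T. ?W T c)"
    by (rule sum.Sigma[symmetric]) (auto simp: finite_staircase_tableaux fin)
  also have "\<dots> = (\<Sum>T\<in>staircase_tableaux n.
      labels_weight n w T * ((a * x + b) * (x + b) ^ card (open_rows n T)))"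
    unfolding a_def b_def first_columns_def sum_distrib_left[symmetric]
      sum_nonempty_bottom_columns[OF finite_open_rows open_rows_less] ..
  finally show ?thesis
    by (simp add: sum_distrib_left mult_ac)
qed

lemma staircase_tableaux_0: "staircase_tableaux 0 = {\<lambda>p. None}"
  by (auto simp: staircase_tableaux_def staircase_tableau_def boxes_def)

text \<open>
  The marker \<open>x\<close> has to be arbitrary in the induction, because the recursion replaces it by
  \<open>x + b\<close>.
\<close>

lemma sum_tableaux_open_rows:
  fixes w :: "label \<Rightarrow> 'a::comm_ring_1"
  defines "a \<equiv> w Alpha + w Gamma" and "b \<equiv> w Beta + w Delta"
  shows "(\<Sum>T\<in>staircase_tableaux n. labels_weight n w T * x ^ card (open_rows n T)) =
    (\<Prod>j<n. a * (x + of_nat j * b) + b)"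
proof (induction n arbitrary: x)
  case 0
  then show ?case
    by (simp add: staircase_tableaux_0 labels_weight_def boxes_def open_rows_def)
next
  case (Suc n)
  show ?case
    unfolding sum_tableaux_Suc[where w = w, folded a_def b_def] Suc.IH prod.lessThan_Suc_shift
    by (simp add: algebra_simps)
qed

lemma blank_weight_1: "blank_weight 1 l l' = 1"
  by (cases l; cases l') auto

lemma tableau_weight_q_1:
  "tableau_weight n \<alpha> \<beta> \<gamma> \<delta> 1 T = labels_weight n (label_weight \<alpha> \<beta> \<gamma> \<delta>) T"
  unfolding tableau_weight_def labels_weight_def
  by (intro prod.cong) (auto simp: blank_weight_1 split: option.split)

theorem proposition2p1:
  fixes n :: nat and \<alpha> \<beta> \<gamma> \<delta> :: "'a::comm_ring_1"
  assumes "n \<ge> 1"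
  shows "fugacity_partition_function n 1 \<alpha> \<beta> \<gamma> \<delta> 1 =
    (\<Prod>j=0..n-1. \<alpha> + \<beta> + \<gamma> + \<delta> + of_nat j * (\<alpha> + \<gamma>) * (\<beta> + \<delta>))"
proof -
  have "fugacity_partition_function n 1 \<alpha> \<beta> \<gamma> \<delta> 1 =
      (\<Prod>j<n. (\<alpha> + \<gamma>) * (1 + of_nat j * (\<beta> + \<delta>)) + (\<beta> + \<delta>))"
    using sum_tableaux_open_rows[of n "label_weight \<alpha> \<beta> \<gamma> \<delta>" 1]
    by (simp add: fugacity_partition_function_def tableau_weight_q_1)
  also have "\<dots> = (\<Prod>j=0..n-1. \<alpha> + \<beta> + \<gamma> + \<delta> + of_nat j * (\<alpha> + \<gamma>) * (\<beta> + \<delta>))"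
    using assms by (intro prod.cong) (auto simp: algebra_simps)
  finally show ?thesis .
qed

end
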